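(* Let $\widehat C$ be the $p\times p$ empirical correlation matrix of an i.i.d. sample of size $n$ with distribution $\mathcal N(\mu,\Sigma)$ on $\mathbb R^p$, and let $\widehat B_\lambda:=B_{n^{-1/3}}$ be the partition of $\{1,\dots,p\}$ given by $\widehat C$ thresholded by $n^{-1/3}$. The complexity of $\widehat B_\lambda$ is $O(p^2)$.
   Context: The setting is the high-dimensional one, where $p$ and $n$ go to infinity. $X^{(1)},\dots,X^{(n)}$ are i.i.d. $\mathcal N(\mu,\Sigma)$ in $\mathbb R^p$, with $\mu$ and the symmetric positive definite matrix $\Sigma$ unknown; $\overline X=\frac1n\sum_{l=1}^nX^{(l)}$, $S=(s_{ij})=\frac1n\sum_{l=1}^n(X^{(l)}-\overline X)(X^{(l)}-\overline X)^T$ is the empirical covariance matrix, and $\widehat C_{ij}=s_{ij}/\sqrt{s_{ii}s_{jj}}$. For a partition $B$ of $\{1,\dots,p\}$ and a symmetric matrix $\Gamma=(\gamma_{ij})$, $\Gamma_B$ has entries $\gamma_{ij}$ when $i,j$ are in the same element of $B$ and $0$ otherwise; $B(\Gamma)$ is the unique finest partition $B$ with $\Gamma=\Gamma_B$. For $\lambda\in[0,1]$, $B_\lambda=B((\widehat C_{ij}\mathbf 1_{|\widehat C_{ij}|>\lambda})_{i,j\le p})$; it can be found by breadth-first search. $\widehat B_\lambda$ is used as an estimator of $B^*=B(\Sigma)$. "Complexity" means computational complexity. *)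

theory Defs
  imports "HOL-Probability.Probability" "HOL-Library.Landau_Symbols" "HOL-Library.Disjoint_Sets"
begin

(* Vectors of R^p are functions on indices {1..p}, and p x p matrices are functions on pairs of
   indices in {1..p}; p has to vary inside statements, so it cannot be a type.  Values outside
   {1..p} are irrelevant.  A sample is x l i: coordinate i of observation l, for l in {1..n}. *)

definition sym_pos_def :: "nat \<Rightarrow> (nat \<Rightarrow> nat \<Rightarrow> real) \<Rightarrow> bool" where
  "sym_pos_def p \<Sigma> \<longleftrightarrow>
     (\<forall>i\<in>{1..p}. \<forall>j\<in>{1..p}. \<Sigma> i j = \<Sigma> j i) \<and>
     (\<forall>a. (\<exists>i\<in>{1..p}. a i \<noteq> 0) \<longrightarrow> 0 < (\<Sum>i=1..p. \<Sum>j=1..p. a i * \<Sigma> i j * a j))"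

(* N(mu, Sigma) for positive definite Sigma: every nontrivial linear combination a.Y of the
   coordinates is normal with mean a.mu and variance a.(Sigma a) > 0. *)
definition gaussian_vector ::
  "'w measure \<Rightarrow> nat \<Rightarrow> (nat \<Rightarrow> real) \<Rightarrow> (nat \<Rightarrow> nat \<Rightarrow> real) \<Rightarrow> ('w \<Rightarrow> nat \<Rightarrow> real) \<Rightarrow> bool" where
  "gaussian_vector M p \<mu> \<Sigma> Y \<longleftrightarrow>
     Y \<in> measurable M (PiM {1..p} (\<lambda>_. borel)) \<and>
     (\<forall>a. (\<exists>i\<in>{1..p}. a i \<noteq> 0) \<longrightarrow>
        distributed M lborel (\<lambda>\<omega>. \<Sum>i=1..p. a i * Y \<omega> i)
          (normal_density (\<Sum>i=1..p. a i * \<mu> i)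
             (sqrt (\<Sum>i=1..p. \<Sum>j=1..p. a i * \<Sigma> i j * a j))))"

definition iid_gaussian_sample ::
  "'w measure \<Rightarrow> nat \<Rightarrow> nat \<Rightarrow> (nat \<Rightarrow> real) \<Rightarrow> (nat \<Rightarrow> nat \<Rightarrow> real) \<Rightarrow>
     (nat \<Rightarrow> 'w \<Rightarrow> nat \<Rightarrow> real) \<Rightarrow> bool" where
  "iid_gaussian_sample M p n \<mu> \<Sigma> X \<longleftrightarrow>
     prob_space M \<and>
     prob_space.indep_vars M (\<lambda>_. PiM {1..p} (\<lambda>_. borel)) X {1..n} \<and>
     (\<forall>l\<in>{1..n}. gaussian_vector M p \<mu> \<Sigma> (X l))"

definition emp_mean :: "nat \<Rightarrow> (nat \<Rightarrow> nat \<Rightarrow> real) \<Rightarrow> nat \<Rightarrow> real" where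
  "emp_mean n x i = (\<Sum>l=1..n. x l i) / real n"

definition emp_cov :: "nat \<Rightarrow> (nat \<Rightarrow> nat \<Rightarrow> real) \<Rightarrow> nat \<Rightarrow> nat \<Rightarrow> real" where
  "emp_cov n x i j = (\<Sum>l=1..n. (x l i - emp_mean n x i) * (x l j - emp_mean n x j)) / real n"

(* By the convention z / 0 = 0, a correlation with a degenerate coordinate is 0. *)
definition emp_corr :: "nat \<Rightarrow> (nat \<Rightarrow> nat \<Rightarrow> real) \<Rightarrow> nat \<Rightarrow> nat \<Rightarrow> real" where
  "emp_corr n x i j = emp_cov n x i j / sqrt (emp_cov n x i i * emp_cov n x j j)"

definition restrict_blocks ::
  "nat set set \<Rightarrow> (nat \<Rightarrow> nat \<Rightarrow> real) \<Rightarrow> nat \<Rightarrow> nat \<Rightarrow> real" where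
  "restrict_blocks B \<Gamma> i j = (if \<exists>b\<in>B. i \<in> b \<and> j \<in> b then \<Gamma> i j else 0)"

definition block_diagonal :: "nat \<Rightarrow> nat set set \<Rightarrow> (nat \<Rightarrow> nat \<Rightarrow> real) \<Rightarrow> bool" where
  "block_diagonal p B \<Gamma> \<longleftrightarrow>
     partition_on {1..p} B \<and> (\<forall>i\<in>{1..p}. \<forall>j\<in>{1..p}. \<Gamma> i j = restrict_blocks B \<Gamma> i j)"

definition finest_partition :: "nat \<Rightarrow> (nat \<Rightarrow> nat \<Rightarrow> real) \<Rightarrow> nat set set" where
  "finest_partition p \<Gamma> =
     (THE B. block_diagonal p B \<Gamma> \<and> (\<forall>B'. block_diagonal p B' \<Gamma> \<longrightarrow> refines {1..p} B B'))"

definition threshold_partition :: "nat \<Rightarrow> real \<Rightarrow> (nat \<Rightarrow> nat \<Rightarrow> real) \<Rightarrow> nat set set" where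
  "threshold_partition p thr C = finest_partition p (\<lambda>i j. if \<bar>C i j\<bar> > thr then C i j else 0)"

definition B_hat :: "nat \<Rightarrow> nat \<Rightarrow> (nat \<Rightarrow> nat \<Rightarrow> real) \<Rightarrow> nat set set" where
  "B_hat p n C = threshold_partition p (real n powr (- 1 / 3)) C"

(* Complexity is the number of elementary operations of a real RAM: registers and indirectly
   addressed memory, separately for naturals and for reals.  To keep unit costs honest, naturals
   have no multiplication or division, reals have no rounding, and the only constants in programs
   are naturals.  Programs are structured (while programs instead of jumps). *)

record ram =
  ireg :: "nat \<Rightarrow> nat"
  imem :: "nat \<Rightarrow> nat"
  rreg :: "nat \<Rightarrow> real"
  rmem :: "nat \<Rightarrow> real"

datatype instr =
    IConst nat nat
  | IAdd nat nat nat
  | ISub nat nat nat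
  | ILoad nat nat
  | IStore nat nat
  | ROfNat nat nat
  | RAdd nat nat nat
  | RSub nat nat nat
  | RMul nat nat nat
  | RDiv nat nat nat
  | RLoad nat nat
  | RStore nat nat

(* The first argument is the target register, except in the store instructions, where it is
   the register that holds the address. *)
fun exec_instr :: "instr \<Rightarrow> ram \<Rightarrow> ram" where
  "exec_instr (IConst d k) s = s\<lparr>ireg := (ireg s)(d := k)\<rparr>"
| "exec_instr (IAdd d a b) s = s\<lparr>ireg := (ireg s)(d := ireg s a + ireg s b)\<rparr>"
| "exec_instr (ISub d a b) s = s\<lparr>ireg := (ireg s)(d := ireg s a - ireg s b)\<rparr>"
| "exec_instr (ILoad d a) s = s\<lparr>ireg := (ireg s)(d := imem s (ireg s a))\<rparr>"
| "exec_instr (IStore a b) s = s\<lparr>imem := (imem s)(ireg s a := ireg s b)\<rparr>"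
| "exec_instr (ROfNat d a) s = s\<lparr>rreg := (rreg s)(d := real (ireg s a))\<rparr>"
| "exec_instr (RAdd d a b) s = s\<lparr>rreg := (rreg s)(d := rreg s a + rreg s b)\<rparr>"
| "exec_instr (RSub d a b) s = s\<lparr>rreg := (rreg s)(d := rreg s a - rreg s b)\<rparr>"
| "exec_instr (RMul d a b) s = s\<lparr>rreg := (rreg s)(d := rreg s a * rreg s b)\<rparr>"
| "exec_instr (RDiv d a b) s = s\<lparr>rreg := (rreg s)(d := rreg s a / rreg s b)\<rparr>"
| "exec_instr (RLoad d a) s = s\<lparr>rreg := (rreg s)(d := rmem s (ireg s a))\<rparr>"
| "exec_instr (RStore a b) s = s\<lparr>rmem := (rmem s)(ireg s a := rreg s b)\<rparr>"

datatype test = ILess nat nat | IEq nat nat | RLess nat nat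

fun holds :: "test \<Rightarrow> ram \<Rightarrow> bool" where
  "holds (ILess a b) s \<longleftrightarrow> ireg s a < ireg s b"
| "holds (IEq a b) s \<longleftrightarrow> ireg s a = ireg s b"
| "holds (RLess a b) s \<longleftrightarrow> rreg s a < rreg s b"

datatype prog = Skip | Do instr | Then prog prog | Cond test prog prog | While test prog

(* runs P s t s': started in s, P halts in s' after t unit-cost steps. *)
inductive runs :: "prog \<Rightarrow> ram \<Rightarrow> nat \<Rightarrow> ram \<Rightarrow> bool" where
  Skip: "runs Skip s 1 s"
| Do: "runs (Do c) s 1 (exec_instr c s)"
| Then: "runs P s t s' \<Longrightarrow> runs Q s' u s'' \<Longrightarrow> runs (Then P Q) s (t + u) s''"
| CondTrue: "holds b s \<Longrightarrow> runs P s t s' \<Longrightarrow> runs (Cond b P Q) s (1 + t) s'"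
| CondFalse: "\<not> holds b s \<Longrightarrow> runs Q s t s' \<Longrightarrow> runs (Cond b P Q) s (1 + t) s'"
| WhileFalse: "\<not> holds b s \<Longrightarrow> runs (While b P) s 1 s"
| WhileTrue: "holds b s \<Longrightarrow> runs P s t s' \<Longrightarrow> runs (While b P) s' u s'' \<Longrightarrow>
    runs (While b P) s (1 + t + u) s''"

(* Input: p and n in the first two registers, the matrix in row-major order in the first p * p
   real memory cells, and 0 everywhere else. *)
definition corr_input :: "nat \<Rightarrow> nat \<Rightarrow> (nat \<Rightarrow> nat \<Rightarrow> real) \<Rightarrow> ram" where
  "corr_input p n C = \<lparr>
     ireg = (\<lambda>_. 0)(0 := p, 1 := n),
     imem = (\<lambda>_. 0),
     rreg = (\<lambda>_. 0),
     rmem = (\<lambda>k. if k < p * p then C (k div p + 1) (k mod p + 1) else 0)\<rparr>"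

(* Output: memory cell i holds the label of the block of i, for i in {1..p}. *)
definition output_partition :: "nat \<Rightarrow> ram \<Rightarrow> nat set set" where
  "output_partition p s = (\<lambda>i. {j \<in> {1..p}. imem s j = imem s i}) ` {1..p}"

end

theory Submission
  imports Defs
begin

text \<open>
  The blocks of \<open>B_hat\<close> are the connected components of the graph on \<open>{1..p}\<close> in which \<open>i\<close> and \<open>j\<close>
  are adjacent when \<open>\<bar>C i j\<bar> > n powr (- 1 / 3)\<close>: a partition leaves the thresholded matrix
  unchanged exactly when no edge joins two of its blocks. So it suffices to find the components
  of a graph given by its adjacency matrix, in time proportional to the size of that matrix.

  The components are built up by adding the edges of one row of the matrix after another, while
  each vertex carries the label of its current component. Row \<open>i\<close> merges the component of \<open>i\<close>
  with the components of all its neighbours. A first pass over the row stamps the label of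
  \<open>i\<close> and the labels of its neighbours with the number \<open>i\<close>; a second pass gives the new label \<open>i\<close>
  to every vertex whose label is stamped. Since the stamps of earlier rows are smaller than \<open>i\<close>,
  they never have to be erased. Both passes take \<open>O(p)\<close> steps in the worst case, so the \<open>p\<close> rows
  take \<open>O(p\<^sup>2)\<close>, with no amortisation. That one row does the right thing to the components
  is \<open>labels_after_next_row\<close>; that the program performs it in linear time is \<open>row_body_achieves\<close>.

  The machine has no roots, so the program cannot form the threshold itself. It decides
  \<open>\<bar>c\<bar> > n powr (- 1 / 3)\<close> by the equivalent test \<open>1 < c ^ 6 * n ^ 2\<close>, a bounded number of
  multiplications; the even power also disposes of the absolute value.

  The bound on the time depends on \<open>p\<close> alone and not on the entries of the matrix, so it is the same at
  every point of the sample space.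
\<close>

section \<open>Running times of structured programs\<close>

text \<open>
  Total correctness with a time budget. The time is only bounded from above, so that the branches of
  a conditional and the iterations of a loop can share one budget.
\<close>

definition achieves :: "prog \<Rightarrow> nat \<Rightarrow> ram \<Rightarrow> (ram \<Rightarrow> bool) \<Rightarrow> bool" where
  "achieves P t s Q \<longleftrightarrow> (\<exists>u s'. runs P s u s' \<and> u \<le> t \<and> Q s')"

lemma achieves_mono:
  assumes "achieves P t s Q" "\<And>s'. Q s' \<Longrightarrow> Q' s'" "t \<le> t'"
  shows "achieves P t' s Q'"
  using assms unfolding achieves_def by (meson le_trans)

lemma achieves_Then:
  assumes "achieves P t s R" "\<And>s'. R s' \<Longrightarrow> achieves P' t' s' Q"
  shows "achieves (Then P P') (t + t') s Q"
  using assms unfolding achieves_def by (meson add_mono runs.Then)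

lemma achieves_Cond:
  assumes "holds b s \<Longrightarrow> achieves P t s Q" "\<not> holds b s \<Longrightarrow> achieves P' t s Q"
  shows "achieves (Cond b P P') (1 + t) s Q"
proof (cases "holds b s")
  case True
  then show ?thesis
    using assms(1) unfolding achieves_def by (meson CondTrue add_left_mono)
next
  case False
  then show ?thesis
    using assms(2) unfolding achieves_def by (meson CondFalse add_left_mono)
qed

text \<open>
  Every loop of the program counts a register up to the value of another one. The invariant is
  indexed by the counter and has to determine both registers; this makes the number of
  iterations exactly \<open>N\<close>.
\<close>

lemma achieves_counting_loop:
  assumes start: "I 0 s"
    and counter: "\<And>k s. I k s \<Longrightarrow> ireg s i = k \<and> ireg s q = N"
    and body: "\<And>k s. k < N \<Longrightarrow> I k s \<Longrightarrow> achieves P c s (I (Suc k))"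
  shows "achieves (While (ILess i q) P) (N * (1 + c) + 1) s (I N)"
proof -
  \<comment> \<open>A loop is executed from its front, so the induction is on the number of remaining iterations.\<close>
  have "I (N - m) s \<Longrightarrow> m \<le> N \<Longrightarrow> achieves (While (ILess i q) P) (m * (1 + c) + 1) s (I N)" for m s
  proof (induction m arbitrary: s)
    case 0
    then have "\<not> holds (ILess i q) s" using counter[of "N - 0" s] by simp
    then have "runs (While (ILess i q) P) s 1 s" by (rule WhileFalse)
    with 0 show ?case
      unfolding achieves_def by (intro exI[of _ 1] exI[of _ s]) simp
  next
    case (Suc m)
    then have N: "N - Suc m < N" "Suc (N - Suc m) = N - m" by auto
    with counter[OF Suc.prems(1)] have b: "holds (ILess i q) s" by simp
    from body[OF N(1) Suc.prems(1)] N(2) obtain u s'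
      where u: "runs P s u s'" "u \<le> c" "I (N - m) s'"
      unfolding achieves_def by metis
    with Suc obtain v s''
      where v: "runs (While (ILess i q) P) s' v s''" "v \<le> m * (1 + c) + 1" "I N s''"
      unfolding achieves_def by (meson Suc_leD)
    have "runs (While (ILess i q) P) s (1 + u + v) s''" by (rule WhileTrue[OF b u(1) v(1)])
    moreover have "1 + u + v \<le> Suc m * (1 + c) + 1" using u(2) v(2) by simp
    ultimately show ?case using v(3) unfolding achieves_def by blast
  qed
  from this[of N s] start show ?thesis by simp
qed

fun block :: "instr list \<Rightarrow> prog" where
  "block [] = Skip"
| "block (c # cs) = Then (Do c) (block cs)"

text \<open>
  The effect of straight-line code is a \<open>fold\<close>, which the simplifier evaluates on concrete code;
  the step beyond the length of the code is that of the closing \<open>Skip\<close>.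
\<close>

lemma runs_block: "runs (block cs) s (length cs + 1) (fold exec_instr cs s)"
proof (induction cs arbitrary: s)
  case Nil
  then show ?case by (simp add: runs.Skip[simplified])
next
  case (Cons c cs)
  from runs.Then[OF runs.Do[of c s] Cons[of "exec_instr c s"]] show ?case by simp
qed

lemma achieves_block:
  assumes "Q (fold exec_instr cs s)" "length cs < t"
  shows "achieves (block cs) t s Q"
  unfolding achieves_def
proof (intro exI conjI)
  show "runs (block cs) s (length cs + 1) (fold exec_instr cs s)" by (rule runs_block)
qed (use assms in auto)

section \<open>The finest block-diagonal partition\<close>

text \<open>
  The kernel of \<open>L\<close> is the least equivalence relation on \<open>{1..p}\<close> that contains the relation \<open>E\<close>. It
  is characterised by minimality, not as a reflexive, symmetric and transitive closure: a
  block-diagonal partition enters as just another equivalence relation that contains \<open>E\<close>.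
\<close>

definition finest_labelling :: "nat \<Rightarrow> (nat \<Rightarrow> nat \<Rightarrow> bool) \<Rightarrow> (nat \<Rightarrow> nat) \<Rightarrow> bool" where
  "finest_labelling p E L \<longleftrightarrow>
     (\<forall>a\<in>{1..p}. \<forall>b\<in>{1..p}. E a b \<longrightarrow> L a = L b) \<and>
     (\<forall>r. equiv {1..p} r \<longrightarrow> (\<forall>a\<in>{1..p}. \<forall>b\<in>{1..p}. E a b \<longrightarrow> (a, b) \<in> r) \<longrightarrow>
        (\<forall>a\<in>{1..p}. \<forall>b\<in>{1..p}. L a = L b \<longrightarrow> (a, b) \<in> r))"

lemma finest_labelling_cong:
  assumes "\<And>a b. a \<in> {1..p} \<Longrightarrow> b \<in> {1..p} \<Longrightarrow> E a b \<longleftrightarrow> E' a b"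
  shows "finest_labelling p E L \<longleftrightarrow> finest_labelling p E' L"
  using assms unfolding finest_labelling_def by simp

text \<open>
  A partition \<open>B\<close> is block diagonal for \<open>\<Gamma>\<close> iff the equivalence relation of lying in the same
  block of \<open>B\<close> contains the support of \<open>\<Gamma>\<close>. So the least such relation yields a block-diagonal
  partition that refines all the others, and antisymmetry of refinement makes it the only one.
\<close>

lemma finest_labelling_partition:
  assumes "finest_labelling p (\<lambda>i j. \<Gamma> i j \<noteq> 0) L"
  shows "(\<lambda>i. {j \<in> {1..p}. L j = L i}) ` {1..p} = finest_partition p \<Gamma>"
proof -
  define F where "F = (\<lambda>i. {j \<in> {1..p}. L j = L i}) ` {1..p}"
  have part: "partition_on {1..p} F"
    unfolding F_def by (rule partition_onI) (auto simp: disjnt_def)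
  have diag: "block_diagonal p F \<Gamma>"
    unfolding block_diagonal_def
  proof (intro conjI ballI part)
    fix i j assume ij: "i \<in> {1..p}" "j \<in> {1..p}"
    show "\<Gamma> i j = restrict_blocks F \<Gamma> i j"
    proof (cases "\<Gamma> i j = 0")
      case False
      then have "L i = L j"
        using assms ij unfolding finest_labelling_def by blast
      then have "\<exists>b\<in>F. i \<in> b \<and> j \<in> b"
        unfolding F_def using ij by auto
      then show ?thesis by (simp add: restrict_blocks_def)
    qed (simp add: restrict_blocks_def)
  qed
  have finer: "refines {1..p} F B" if B: "block_diagonal p B \<Gamma>" for B
  proof -
    define r where "r = {(x, y). \<exists>b\<in>B. x \<in> b \<and> y \<in> b}"
    from B have pB: "partition_on {1..p} B" by (simp add: block_diagonal_def)
    then have "equiv {1..p} r" unfolding r_def by (rule equiv_partition_on)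
    moreover have "(a, b) \<in> r" if "a \<in> {1..p}" "b \<in> {1..p}" "\<Gamma> a b \<noteq> 0" for a b
      using B that unfolding block_diagonal_def restrict_blocks_def r_def
      by (smt (verit) case_prodI mem_Collect_eq)
    ultimately have r: "(a, b) \<in> r" if "a \<in> {1..p}" "b \<in> {1..p}" "L a = L b" for a b
      using assms that unfolding finest_labelling_def by blast
    have "\<exists>Y\<in>B. X \<subseteq> Y" if X: "X \<in> F" for X
    proof -
      from X obtain i where i: "i \<in> {1..p}" "X = {j \<in> {1..p}. L j = L i}"
        unfolding F_def by blast
      with pB obtain Y where Y: "Y \<in> B" "i \<in> Y" unfolding partition_on_def by blast
      have "j \<in> Y" if "j \<in> X" for j
      proof -
        from that i r[of i j] obtain Z where "Z \<in> B" "i \<in> Z" "j \<in> Z"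
          unfolding r_def by auto
        with Y pB show ?thesis by (auto simp: partition_on_def disjoint_def)
      qed
      with Y show ?thesis by blast
    qed
    with part pB show ?thesis by (simp add: refines_def)
  qed
  have "finest_partition p \<Gamma> = F"
    unfolding finest_partition_def
  proof (rule the_equality)
    show "block_diagonal p F \<Gamma> \<and> (\<forall>B'. block_diagonal p B' \<Gamma> \<longrightarrow> refines {1..p} F B')"
      using diag finer by blast
    show "B = F" if "block_diagonal p B \<Gamma> \<and> (\<forall>B'. block_diagonal p B' \<Gamma> \<longrightarrow> refines {1..p} B B')" for B
      using that diag finer refines_asym by blast
  qed
  then show ?thesis by (simp add: F_def)
qed

section \<open>Adding the rows of a graph one at a time\<close>

text \<open>
  The last condition says that a label larger than \<open>i\<close> is carried by no vertex but the one
  of that number. It makes \<open>Suc i\<close> safe as the label of the class that the next row creates.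
\<close>

definition labels_after_rows ::
  "nat \<Rightarrow> (nat \<Rightarrow> nat \<Rightarrow> bool) \<Rightarrow> nat \<Rightarrow> (nat \<Rightarrow> nat) \<Rightarrow> bool" where
  "labels_after_rows p E i L \<longleftrightarrow>
     finest_labelling p (\<lambda>a b. a \<le> i \<and> E a b) L \<and>
     (\<forall>k\<in>{1..p}. L k \<in> {1..p} \<and> (i < L k \<longrightarrow> L k = k))"

text \<open>
  The labels stamped by row \<open>i\<close> once its first \<open>j\<close> entries have been read. The label of \<open>i\<close> itself is
  always among them, whether or not the diagonal entry is an edge.
\<close>

definition row_marks :: "(nat \<Rightarrow> nat \<Rightarrow> bool) \<Rightarrow> nat \<Rightarrow> (nat \<Rightarrow> nat) \<Rightarrow> nat \<Rightarrow> nat set" where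
  "row_marks E i L j = insert (L i) (L ` {k \<in> {1..j}. E i k})"

lemma row_marks_Suc:
  "row_marks E i L (Suc j) =
     (if E i (Suc j) then insert (L (Suc j)) (row_marks E i L j) else row_marks E i L j)"
  by (auto simp: row_marks_def le_Suc_eq)

lemma labels_after_no_rows: "labels_after_rows p E 0 (\<lambda>k. k)"
  unfolding labels_after_rows_def finest_labelling_def
  by (auto simp: equiv_def refl_on_def)

text \<open>
  The classes whose labels are marked are those that contain \<open>Suc i\<close> or one of its neighbours. Any
  equivalence relation containing the rows up to \<open>Suc i\<close> must merge them, and nothing else has to be
  merged to accommodate the new edges.
\<close>

lemma labels_after_next_row:
  assumes L: "labels_after_rows p E i L" and i: "Suc i \<le> p"
  shows "labels_after_rows p E (Suc i)
    (\<lambda>k. if L k \<in> row_marks E (Suc i) L p then Suc i else L k)"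
    (is "labels_after_rows p E (Suc i) ?L")
proof -
  define A where "A = row_marks E (Suc i) L p"
  \<comment> \<open>Without this, relabelling could merge the marked classes with an unmarked one that already
     carries the label \<open>Suc i\<close>.\<close>
  have fresh: "L k \<in> A" if "k \<in> {1..p}" "L k = Suc i" for k
    using that L unfolding labels_after_rows_def A_def row_marks_def by force
  have eq: "?L a = ?L b \<longleftrightarrow> L a = L b \<or> L a \<in> A \<and> L b \<in> A" if "a \<in> {1..p}" "b \<in> {1..p}" for a b
    using that fresh[of a] fresh[of b] by (auto simp: A_def[symmetric])
  have "finest_labelling p (\<lambda>a b. a \<le> Suc i \<and> E a b) ?L"
    unfolding finest_labelling_def
  proof (intro conjI allI impI ballI)
    fix a b assume ab: "a \<in> {1..p}" "b \<in> {1..p}" "a \<le> Suc i \<and> E a b"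
    show "?L a = ?L b"
    proof (cases "a = Suc i")
      case True
      with ab have "L a \<in> A" "L b \<in> A" by (auto simp: A_def row_marks_def)
      with ab eq show ?thesis by blast
    next
      case False
      with ab L have "L a = L b"
        by (auto simp: labels_after_rows_def finest_labelling_def)
      with ab eq show ?thesis by blast
    qed
  next
    fix r a b
    assume r: "equiv {1..p} r" "\<forall>a\<in>{1..p}. \<forall>b\<in>{1..p}. a \<le> Suc i \<and> E a b \<longrightarrow> (a, b) \<in> r"
      and ab: "a \<in> {1..p}" "b \<in> {1..p}" "?L a = ?L b"
    have old: "(c, d) \<in> r" if "c \<in> {1..p}" "d \<in> {1..p}" "L c = L d" for c d
      using L r that le_Suc_eq unfolding labels_after_rows_def finest_labelling_def by blast
    have new: "(Suc i, c) \<in> r" if c: "c \<in> {1..p}" "L c \<in> A" for c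
    proof -
      from c(2) consider "L c = L (Suc i)"
        | k where "k \<in> {1..p}" "E (Suc i) k" "L c = L k"
        unfolding A_def row_marks_def by blast
      then show ?thesis
      proof cases
        case 1
        with c i show ?thesis by (intro old) auto
      next
        case 2
        with r i have "(Suc i, k) \<in> r" by auto
        with old[of k c] 2 c r(1) show ?thesis by (metis equivE transD)
      qed
    qed
    from ab eq consider "L a = L b" | "L a \<in> A" "L b \<in> A" by blast
    then show "(a, b) \<in> r"
    proof cases
      case 1
      with ab old show ?thesis by blast
    next
      case 2
      with new ab r(1) show ?thesis by (metis equivE symD transD)
    qed
  qed
  moreover have "?L k \<in> {1..p} \<and> (Suc i < ?L k \<longrightarrow> ?L k = k)" if "k \<in> {1..p}" for k
    using L i that by (auto simp: labels_after_rows_def)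
  ultimately show ?thesis unfolding labels_after_rows_def by blast
qed

lemma labels_after_all_rows:
  assumes "labels_after_rows p E p L"
  shows "finest_labelling p E L"
  using assms unfolding labels_after_rows_def finest_labelling_def by force

section \<open>The program\<close>

text \<open>
  Integer registers: the two inputs \<open>p\<close> and \<open>n\<close>, the constant one, row and column counter, the
  address of the next matrix entry, and two scratch registers. As the machine has no multiplication
  of naturals, the address of entry \<open>(i, j)\<close> is not computed but advanced along the rows.

  Integer memory: cell \<open>k\<close> holds the label of vertex \<open>k\<close>, and cell \<open>p + l\<close> the stamp of label
  \<open>l\<close>; both \<open>k\<close> and \<open>l\<close> range over \<open>{1..p}\<close>, so the two areas are disjoint.

  Real registers: 0 holds \<open>n\<^sup>2\<close>, 1 holds one, 2 the current entry \<open>c\<close>, and 3 the product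
  \<open>c ^ 6 * n\<^sup>2\<close>.
\<close>

abbreviation (input) "rP \<equiv> 0 :: nat"
abbreviation (input) "rN \<equiv> 1 :: nat"
abbreviation (input) "rOne \<equiv> 2 :: nat"
abbreviation (input) "rI \<equiv> 3 :: nat"
abbreviation (input) "rJ \<equiv> 4 :: nat"
abbreviation (input) "rEntry \<equiv> 5 :: nat"
abbreviation (input) "rAddr \<equiv> 6 :: nat"
abbreviation (input) "rVal \<equiv> 7 :: nat"

definition setup_code :: prog where
  "setup_code = block
     [IConst rOne 1, IConst rI 0, IConst rEntry 0,
      ROfNat 0 rN, RMul 0 0 0, ROfNat 1 rOne]"

definition init_loop :: prog where
  "init_loop = While (ILess rI rP) (block [IAdd rI rI rOne, IStore rI rI])"

definition mark_body :: prog where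
  "mark_body = Then
     (block [IAdd rJ rJ rOne, RLoad 2 rEntry, IAdd rEntry rEntry rOne,
             RMul 3 2 2, RMul 3 3 2, RMul 3 3 3, RMul 3 3 0])
     (Cond (RLess 1 3) (block [ILoad rAddr rJ, IAdd rAddr rAddr rP, IStore rAddr rI]) (block []))"

definition relabel_body :: prog where
  "relabel_body = Then
     (block [IAdd rJ rJ rOne, ILoad rAddr rJ, IAdd rAddr rAddr rP, ILoad rVal rAddr])
     (Cond (IEq rVal rI) (block [IStore rJ rI]) (block []))"

definition row_body :: prog where
  "row_body =
     Then (block [IAdd rI rI rOne, ILoad rAddr rI, IAdd rAddr rAddr rP, IStore rAddr rI, IConst rJ 0])
    (Then (While (ILess rJ rP) mark_body)
    (Then (block [IConst rJ 0])
          (While (ILess rJ rP) relabel_body)))"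

definition components_prog :: prog where
  "components_prog =
     Then setup_code
    (Then init_loop
    (Then (block [IConst rI 0])
          (While (ILess rI rP) row_body)))"

section \<open>Correctness and running time of the program\<close>

definition frame :: "nat \<Rightarrow> nat \<Rightarrow> (nat \<Rightarrow> real) \<Rightarrow> ram \<Rightarrow> bool" where
  "frame p n R s \<longleftrightarrow> ireg s rP = p \<and> ireg s rOne = 1 \<and>
     rreg s 0 = real n ^ 2 \<and> rreg s 1 = 1 \<and> rmem s = R"

text \<open>
  The test as the machine performs it, on the matrix stored in memory \<open>R\<close>. Rows and columns are
  numbered from one, addresses from zero.
\<close>

definition edge :: "nat \<Rightarrow> nat \<Rightarrow> (nat \<Rightarrow> real) \<Rightarrow> nat \<Rightarrow> nat \<Rightarrow> bool" where
  "edge p n R i j \<longleftrightarrow> 1 < R ((i - 1) * p + (j - 1)) ^ 6 * real n ^ 2"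

text \<open>
  The invariants of the two passes over row \<open>Suc i\<close> after \<open>j\<close> columns, where \<open>L\<close> is the labelling
  before the row. The bounds on the stamps guarantee that the next row finds no stamp equal to
  its own number.
\<close>

definition mark_inv where
  "mark_inv p n R i L j s \<longleftrightarrow> frame p n R s \<and>
     ireg s rI = Suc i \<and> ireg s rJ = j \<and> ireg s rEntry = i * p + j \<and>
     (\<forall>k\<in>{1..p}. imem s k = L k) \<and>
     (\<forall>l\<in>{1..p}. imem s (p + l) \<le> Suc i \<and>
        (imem s (p + l) = Suc i \<longleftrightarrow> l \<in> row_marks (edge p n R) (Suc i) L j))"

definition relabel_inv where
  "relabel_inv p n R i L j s \<longleftrightarrow> frame p n R s \<and>
     ireg s rI = Suc i \<and> ireg s rJ = j \<and> ireg s rEntry = Suc i * p \<and>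
     (\<forall>k\<in>{1..p}. imem s k =
        (if k \<le> j \<and> L k \<in> row_marks (edge p n R) (Suc i) L p then Suc i else L k)) \<and>
     (\<forall>l\<in>{1..p}. imem s (p + l) \<le> Suc i \<and>
        (imem s (p + l) = Suc i \<longleftrightarrow> l \<in> row_marks (edge p n R) (Suc i) L p))"

definition row_inv where
  "row_inv p n R i s \<longleftrightarrow> frame p n R s \<and> ireg s rI = i \<and> ireg s rEntry = i * p \<and>
     labels_after_rows p (edge p n R) i (imem s) \<and>
     (\<forall>l\<in>{1..p}. imem s (p + l) \<le> i)"

lemma mark_body_achieves:
  assumes j: "j < p" and L: "\<forall>k\<in>{1..p}. L k \<in> {1..p}" and inv: "mark_inv p n R i L j s"
  shows "achieves mark_body 13 s (mark_inv p n R i L (Suc j))"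
proof -
  define s1 where "s1 = fold exec_instr [IAdd rJ rJ rOne, RLoad 2 rEntry, IAdd rEntry rEntry rOne,
             RMul 3 2 2, RMul 3 3 2, RMul 3 3 3, RMul 3 3 0] s"
  have s1: "frame p n R s1" "ireg s1 rI = Suc i" "ireg s1 rJ = Suc j"
    "ireg s1 rEntry = i * p + Suc j" "imem s1 = imem s"
    and test: "holds (RLess 1 3) s1 \<longleftrightarrow> edge p n R (Suc i) (Suc j)"
    using inv by (simp_all add: s1_def mark_inv_def frame_def edge_def power_numeral_reduce
        power2_eq_square mult.assoc)
  have Lj: "L (Suc j) \<in> {1..p}" using L j by simp
  have "achieves (Cond (RLess 1 3) (block [ILoad rAddr rJ, IAdd rAddr rAddr rP, IStore rAddr rI])
    (block [])) (1 + 4) s1 (mark_inv p n R i L (Suc j))"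
  proof (intro achieves_Cond achieves_block)
    assume "holds (RLess 1 3) s1"
    then have "edge p n R (Suc i) (Suc j)" using test by simp
    then show "mark_inv p n R i L (Suc j)
      (fold exec_instr [ILoad rAddr rJ, IAdd rAddr rAddr rP, IStore rAddr rI] s1)"
      using inv s1 Lj j by (auto simp: mark_inv_def frame_def row_marks_Suc)
  next
    assume "\<not> holds (RLess 1 3) s1"
    then have "\<not> edge p n R (Suc i) (Suc j)" using test by simp
    then show "mark_inv p n R i L (Suc j) (fold exec_instr [] s1)"
      using inv s1 by (auto simp: mark_inv_def row_marks_Suc)
  qed simp_all
  then have "achieves mark_body (8 + (1 + 4)) s (mark_inv p n R i L (Suc j))"
    unfolding mark_body_def
    by (intro achieves_Then[where R = "\<lambda>s'. s' = s1"] achieves_block) (simp_all add: s1_def)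
  then show ?thesis by simp
qed

lemma relabel_body_achieves:
  assumes j: "j < p" and L: "\<forall>k\<in>{1..p}. L k \<in> {1..p}" and inv: "relabel_inv p n R i L j s"
  shows "achieves relabel_body 8 s (relabel_inv p n R i L (Suc j))"
proof -
  define s1 where "s1 = fold exec_instr
    [IAdd rJ rJ rOne, ILoad rAddr rJ, IAdd rAddr rAddr rP, ILoad rVal rAddr] s"
  have Lj: "L (Suc j) \<in> {1..p}" using L j by simp
  have s1: "frame p n R s1" "ireg s1 rI = Suc i" "ireg s1 rJ = Suc j"
    "ireg s1 rEntry = Suc i * p" "imem s1 = imem s"
    using inv by (simp_all add: s1_def relabel_inv_def frame_def)
  have "ireg s1 rVal = imem s (p + L (Suc j))"
    using inv j by (simp add: s1_def relabel_inv_def frame_def add.commute)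
  then have test: "holds (IEq rVal rI) s1 \<longleftrightarrow> L (Suc j) \<in> row_marks (edge p n R) (Suc i) L p"
    using inv s1 Lj by (simp add: relabel_inv_def)
  have "achieves (Cond (IEq rVal rI) (block [IStore rJ rI]) (block []))
    (1 + 2) s1 (relabel_inv p n R i L (Suc j))"
  proof (intro achieves_Cond achieves_block)
    assume "holds (IEq rVal rI) s1"
    then show "relabel_inv p n R i L (Suc j) (fold exec_instr [IStore rJ rI] s1)"
      using inv s1 test j by (auto simp: relabel_inv_def frame_def le_Suc_eq)
  next
    assume "\<not> holds (IEq rVal rI) s1"
    then show "relabel_inv p n R i L (Suc j) (fold exec_instr [] s1)"
      using inv s1 test by (auto simp: relabel_inv_def le_Suc_eq)
  qed simp_all
  then have "achieves relabel_body (5 + (1 + 2)) s (relabel_inv p n R i L (Suc j))"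
    unfolding relabel_body_def
    by (intro achieves_Then[where R = "\<lambda>s'. s' = s1"] achieves_block) (simp_all add: s1_def)
  then show ?thesis by simp
qed

lemma labels_after_rows_cong:
  assumes "\<And>k. k \<in> {1..p} \<Longrightarrow> L k = L' k"
  shows "labels_after_rows p E i L \<longleftrightarrow> labels_after_rows p E i L'"
  using assms unfolding labels_after_rows_def finest_labelling_def by simp

text \<open>
  Marking takes at most 13 steps and relabelling at most 8 steps per column, to which each loop
  adds the test of its guard; the code around the two loops accounts for the constant.
\<close>

lemma row_body_achieves:
  assumes i: "i < p" and inv: "row_inv p n R i s"
  shows "achieves row_body (23 * p + 10) s (row_inv p n R (Suc i))"
proof -
  define L where "L = imem s"
  have lab: "labels_after_rows p (edge p n R) i L"
    using inv by (simp add: row_inv_def L_def)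
  then have L: "\<forall>k\<in>{1..p}. L k \<in> {1..p}" by (simp add: labels_after_rows_def)
  then have Li: "L (Suc i) \<in> {1..p}" using i by simp
  have "achieves (block [IAdd rI rI rOne, ILoad rAddr rI, IAdd rAddr rAddr rP, IStore rAddr rI,
    IConst rJ 0]) 6 s (mark_inv p n R i L 0)"
    using inv Li i
    by (intro achieves_block)
      (auto simp: row_inv_def mark_inv_def frame_def row_marks_def L_def[symmetric] le_Suc_eq add.commute
         dest: bspec)
  moreover have "achieves (While (ILess rJ rP) mark_body) (p * (1 + 13) + 1) s (mark_inv p n R i L p)"
    if "mark_inv p n R i L 0 s" for s
  proof (rule achieves_counting_loop[where I = "mark_inv p n R i L"])
    show "ireg s rJ = k \<and> ireg s rP = p" if "mark_inv p n R i L k s" for k s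
      using that by (simp add: mark_inv_def frame_def)
  qed (use that mark_body_achieves[OF _ L] in blast)+
  moreover have "achieves (block [IConst rJ 0]) 2 s (relabel_inv p n R i L 0)"
    if "mark_inv p n R i L p s" for s
    using that by (intro achieves_block) (auto simp: mark_inv_def relabel_inv_def frame_def)
  moreover have "achieves (While (ILess rJ rP) relabel_body) (p * (1 + 8) + 1) s (relabel_inv p n R i L p)"
    if "relabel_inv p n R i L 0 s" for s
  proof (rule achieves_counting_loop[where I = "relabel_inv p n R i L"])
    show "ireg s rJ = k \<and> ireg s rP = p" if "relabel_inv p n R i L k s" for k s
      using that by (simp add: relabel_inv_def frame_def)
  qed (use that relabel_body_achieves[OF _ L] in blast)+
  ultimately have "achieves row_body (6 + ((p * (1 + 13) + 1) + (2 + (p * (1 + 8) + 1)))) s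
    (relabel_inv p n R i L p)"
    unfolding row_body_def by (intro achieves_Then)
  moreover have "row_inv p n R (Suc i) s'" if "relabel_inv p n R i L p s'" for s'
  proof -
    have "labels_after_rows p (edge p n R) (Suc i) (imem s')"
      using labels_after_next_row[OF lab] that i
      by (subst labels_after_rows_cong[where L' =
            "\<lambda>k. if L k \<in> row_marks (edge p n R) (Suc i) L p then Suc i else L k"])
         (auto simp: relabel_inv_def)
    with that show ?thesis by (simp add: row_inv_def relabel_inv_def)
  qed
  moreover have "6 + ((p * (1 + 13) + 1) + (2 + (p * (1 + 8) + 1))) \<le> 23 * p + 10"
    by simp
  ultimately show ?thesis by (rule achieves_mono)
qed

lemma components_prog_achieves:
  "achieves components_prog (p * (23 * p + 15) + 11) (corr_input p n C)
     (\<lambda>s. finest_labelling p (edge p n (rmem (corr_input p n C))) (imem s))"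
proof -
  define R where "R = rmem (corr_input p n C)"
  define init_inv where "init_inv i s \<longleftrightarrow> frame p n R s \<and> ireg s rI = i \<and> ireg s rEntry = 0 \<and>
     (\<forall>k. imem s k = (if k \<in> {1..i} then k else 0))" for i s
  have "achieves setup_code 7 (corr_input p n C) (init_inv 0)"
    unfolding setup_code_def
    by (intro achieves_block)
      (simp_all add: init_inv_def frame_def R_def corr_input_def power2_eq_square)
  moreover have "achieves init_loop (p * (1 + 3) + 1) s (init_inv p)" if "init_inv 0 s" for s
    unfolding init_loop_def using that
    by (intro achieves_counting_loop[where I = init_inv] achieves_block)
      (auto simp: init_inv_def frame_def)
  moreover have "achieves (block [IConst rI 0]) 2 s (row_inv p n R 0)" if "init_inv p s" for s
  proof (intro achieves_block)
    have "labels_after_rows p (edge p n R) 0 (imem s)"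
      using labels_after_no_rows that
      by (subst labels_after_rows_cong[where L' = "\<lambda>k. k"]) (auto simp: init_inv_def)
    then show "row_inv p n R 0 (fold exec_instr [IConst rI 0] s)"
      using that by (auto simp: row_inv_def init_inv_def frame_def)
  qed simp
  moreover have "achieves (While (ILess rI rP) row_body) (p * (1 + (23 * p + 10)) + 1) s
      (row_inv p n R p)" if "row_inv p n R 0 s" for s
  proof (rule achieves_counting_loop[where I = "row_inv p n R"])
    show "ireg s rI = k \<and> ireg s rP = p" if "row_inv p n R k s" for k s
      using that by (simp add: row_inv_def frame_def)
  qed (use that row_body_achieves in blast)+
  ultimately have "achieves components_prog
    (7 + ((p * (1 + 3) + 1) + (2 + (p * (1 + (23 * p + 10)) + 1)))) (corr_input p n C)
    (row_inv p n R p)"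
    unfolding components_prog_def by (intro achieves_Then)
  then show ?thesis
  proof (rule achieves_mono)
    show "finest_labelling p (edge p n (rmem (corr_input p n C))) (imem s)"
      if "row_inv p n R p s" for s
      using that labels_after_all_rows unfolding row_inv_def R_def by blast
    show "7 + ((p * (1 + 3) + 1) + (2 + (p * (1 + (23 * p + 10)) + 1))) \<le> p * (23 * p + 15) + 11"
      by (simp add: distrib_left)
  qed
qed

section \<open>The threshold\<close>

text \<open>
  Both sides of \<open>t < \<bar>c\<bar>\<close> are raised to the sixth power, the least exponent that is even and a
  multiple of three, and multiplied by \<open>n\<^sup>2\<close>, which turns the side of the threshold into one.
\<close>

lemma above_cube_root_threshold_iff:
  fixes c :: real
  assumes "1 \<le> n"
  shows "real n powr (- 1 / 3) < \<bar>c\<bar> \<longleftrightarrow> 1 < c ^ 6 * real n ^ 2"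
proof -
  define t where "t = real n powr (- 1 / 3)"
  have t: "0 < t" using assms by (simp add: t_def)
  have "t ^ 6 = real n powr (- 2)"
    unfolding t_def by (subst powr_power) (use assms in auto)
  then have t6: "t ^ 6 * real n ^ 2 = 1"
    using assms by (simp add: powr_minus)
  have "\<bar>c\<bar> ^ 6 \<le> t ^ 6 \<longleftrightarrow> \<bar>c\<bar> \<le> t"
    using t by (intro power_mono_iff) auto
  then have "t < \<bar>c\<bar> \<longleftrightarrow> t ^ 6 < \<bar>c\<bar> ^ 6" by linarith
  also have "\<dots> \<longleftrightarrow> t ^ 6 * real n ^ 2 < \<bar>c\<bar> ^ 6 * real n ^ 2"
    using assms by simp
  also have "\<dots> \<longleftrightarrow> 1 < c ^ 6 * real n ^ 2" by (simp add: t6)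
  finally show ?thesis unfolding t_def .
qed

lemma edge_corr_input:
  assumes "i \<in> {1..p}" "j \<in> {1..p}" "1 \<le> n"
  shows "edge p n (rmem (corr_input p n C)) i j \<longleftrightarrow> real n powr (- 1 / 3) < \<bar>C i j\<bar>"
proof -
  obtain i' j' where ij: "i = Suc i'" "j = Suc j'" "i' < p" "j' < p"
    using assms by (metis Suc_le_lessD Suc_pred' atLeastAtMost_iff less_eq_Suc_le One_nat_def)
  \<comment> \<open>The address lies inside the matrix, and its quotient and remainder by \<open>p\<close> return row and column.\<close>
  have "i' * p + j' < Suc i' * p" using ij by simp
  also have "\<dots> \<le> p * p" using ij by (intro mult_right_mono) auto
  finally have "rmem (corr_input p n C) ((i - 1) * p + (j - 1)) = C i j"
    using ij by (simp add: corr_input_def)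
  then show ?thesis
    unfolding edge_def above_cube_root_threshold_iff[OF assms(3)] by simp
qed

lemma components_prog_computes_B_hat:
  assumes "1 \<le> n"
  shows "achieves components_prog (p * (23 * p + 15) + 11) (corr_input p n C)
    (\<lambda>s. output_partition p s = B_hat p n C)"
proof (rule achieves_mono[OF components_prog_achieves])
  fix s :: ram
  let ?E = "edge p n (rmem (corr_input p n C))"
  let ?\<Gamma> = "\<lambda>i j. if \<bar>C i j\<bar> > real n powr (- 1 / 3) then C i j else 0"
  \<comment> \<open>An entry above the threshold is nonzero because the threshold is nonnegative.\<close>
  have "?E i j \<longleftrightarrow> ?\<Gamma> i j \<noteq> 0" if "i \<in> {1..p}" "j \<in> {1..p}" for i j
    using edge_corr_input[OF that assms] powr_ge_zero[of "real n" "- 1 / 3"] by auto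
  then have "finest_labelling p ?E (imem s) \<longleftrightarrow> finest_labelling p (\<lambda>i j. ?\<Gamma> i j \<noteq> 0) (imem s)"
    by (rule finest_labelling_cong)
  moreover assume "finest_labelling p ?E (imem s)"
  ultimately have "finest_labelling p (\<lambda>i j. ?\<Gamma> i j \<noteq> 0) (imem s)" by (rule iffD1)
  from finest_labelling_partition[OF this]
  show "output_partition p s = B_hat p n C"
    unfolding output_partition_def B_hat_def threshold_partition_def .
qed simp

theorem proposition5:
  shows "\<exists>(P :: prog) (T :: nat \<Rightarrow> nat).
    (\<lambda>p. real (T p)) \<in> O(\<lambda>p. real p ^ 2) \<and>
    (\<forall>p n \<mu> \<Sigma> (M :: 'w measure) X. 1 \<le> p \<longrightarrow> 1 \<le> n \<longrightarrow> sym_pos_def p \<Sigma> \<longrightarrow>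
       iid_gaussian_sample M p n \<mu> \<Sigma> X \<longrightarrow>
       (\<forall>\<omega>\<in>space M.
          let C = emp_corr n (\<lambda>l. X l \<omega>) in
          \<exists>t s. runs P (corr_input p n C) t s \<and> t \<le> T p \<and>
                output_partition p s = B_hat p n C))"
proof (intro exI conjI)
  show "(\<lambda>p. real (p * (23 * p + 15) + 11)) \<in> O(\<lambda>p. real p ^ 2)"
  \<comment> \<open>For \<open>p \<ge> 1\<close> the lower powers of \<open>p\<close> are at most \<open>p\<^sup>2\<close>, and \<open>23 + 15 + 11 = 49\<close>.\<close>
  proof (rule bigoI[where c = 49], rule eventually_sequentiallyI[of 1])
    fix p :: nat assume "1 \<le> p"
    then have "1 \<le> real p" "real p \<le> real p ^ 2" by (simp_all add: self_le_power)
    then have "23 * real p ^ 2 + 15 * real p + 11 \<le> 49 * real p ^ 2" by linarith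
    then show "norm (real (p * (23 * p + 15) + 11)) \<le> 49 * norm (real p ^ 2)"
      by (simp add: algebra_simps power2_eq_square)
  qed
  show "\<forall>p n \<mu> \<Sigma> (M :: 'w measure) X. 1 \<le> p \<longrightarrow> 1 \<le> n \<longrightarrow> sym_pos_def p \<Sigma> \<longrightarrow>
       iid_gaussian_sample M p n \<mu> \<Sigma> X \<longrightarrow>
       (\<forall>\<omega>\<in>space M.
          let C = emp_corr n (\<lambda>l. X l \<omega>) in
          \<exists>t s. runs components_prog (corr_input p n C) t s \<and> t \<le> p * (23 * p + 15) + 11 \<and>
                output_partition p s = B_hat p n C)"
    using components_prog_computes_B_hat unfolding achieves_def Let_def by blast
qed

end
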